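(* Consider the mesh patterns $$m_1=(12,\{(1,0),(1,1),(1,2),(2,0),(2,1)\}),\qquad m_2=(21,\{(0,1),(1,0),(1,1),(1,2),(2,1)\}).$$ Then $|\mathrm{Av}_n(\{231,m_1\})|=|\mathrm{Av}_n(\{231,m_2\})|$ for all $n\ge0$, and the common generating function $P(x)=\sum_{n\ge0}|\mathrm{Av}_n(\{231,m_i\})|x^n$ satisfies $$P(x)=xP(x)^2-x(P(x)-1)+1.$$ Its coefficients $1,1,1,2,4,9,21,51,\dots$ are an offset of the Motzkin numbers: for $n\ge1$ the coefficient of $x^n$ is the Motzkin number $M_{n-1}$ (where $M_0=1,M_1=1,M_2=2,M_3=4,\dots$).
   Context: Write $[n]=\{1,\dots,n\}$. A permutation of length $n$ is a bijection of $[n]$, written in one-line notation; $G(\pi)=\{(i,\pi(i)) : i\in[n]\}$ is its plot. A mesh pattern of length $k$ is a pair $p=(\tau,R)$ with $\tau$ a permutation of length $k$ and $R\subseteq\{0,\dots,k\}^2$. An occurrence of $p$ in a permutation $\pi$ of length $n$ is a subset $\omega\subseteq G(\pi)$ for which there are order-preserving injections $\alpha,\beta:[k]\to[n]$ such that (i) $\omega=\{(\alpha(i),\beta(j)):(i,j)\in G(\tau)\}$, and (ii) with $\alpha(0)=\beta(0)=0$, $\alpha(k+1)=\beta(k+1)=n+1$ and $R_{ij}=[\alpha(i)+1,\alpha(i+1)-1]\times[\beta(j)+1,\beta(j+1)-1]$, one has $R_{ij}\cap G(\pi)=\emptyset$ for every $(i,j)\in R$. A permutation avoids $p$ if it has no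 occurrence of $p$. A classical pattern $\pi$ is identified with the mesh pattern $(\pi,\emptyset)$. $\mathrm{Av}_n(S)$ is the set of all permutations of length $n$ (including the empty permutation for $n=0$) avoiding every pattern in $S$. *)

theory Defs
  imports
    "HOL-Combinatorics.Multiset_Permutations"
    "HOL-Computational_Algebra.Formal_Power_Series"
begin

text \<open>
  Permutations of length \<open>n\<close> are given in one-line notation, as the lists in
  \<^term>\<open>permutations_of_set {1..n}\<close>; the \<open>i\<close>-th letter (counting from 1) of \<open>\<pi>\<close> is \<open>\<pi> ! (i - 1)\<close>.
\<close>

definition plot :: "nat list \<Rightarrow> (nat \<times> nat) set" where
  "plot \<pi> = {(Suc i, \<pi> ! i) | i. i < length \<pi>}"

type_synonym mesh_pattern = "nat list \<times> (nat \<times> nat) set"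

definition is_mesh_pattern :: "nat \<Rightarrow> mesh_pattern \<Rightarrow> bool" where
  "is_mesh_pattern k p \<longleftrightarrow>
     fst p \<in> permutations_of_set {1..k} \<and> snd p \<subseteq> {0..k} \<times> {0..k}"

definition order_preserving_injection :: "nat \<Rightarrow> nat \<Rightarrow> (nat \<Rightarrow> nat) \<Rightarrow> bool" where
  "order_preserving_injection k n \<alpha> \<longleftrightarrow>
     \<alpha> ` {1..k} \<subseteq> {1..n} \<and> inj_on \<alpha> {1..k} \<and> mono_on {1..k} \<alpha>"

text \<open>
  The functions \<open>\<alpha>\<close> and \<open>\<beta>\<close> are the order-preserving injections already extended to \<open>0\<close> and
  \<open>k + 1\<close>. The truncated subtraction on the naturals is harmless here, since \<open>\<alpha> (i + 1)\<close> and
  \<open>\<beta> (j + 1)\<close> are positive for \<open>i, j \<le> k\<close>.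
\<close>

definition mesh_box ::
    "(nat \<Rightarrow> nat) \<Rightarrow> (nat \<Rightarrow> nat) \<Rightarrow> nat \<Rightarrow> nat \<Rightarrow> (nat \<times> nat) set" where
  "mesh_box \<alpha> \<beta> i j = {\<alpha> i + 1..\<alpha> (i + 1) - 1} \<times> {\<beta> j + 1..\<beta> (j + 1) - 1}"

definition is_occurrence :: "mesh_pattern \<Rightarrow> nat list \<Rightarrow> (nat \<times> nat) set \<Rightarrow> bool" where
  "is_occurrence p \<pi> \<omega> \<longleftrightarrow>
     (let \<tau> = fst p; R = snd p; k = length \<tau>; n = length \<pi> in
      \<omega> \<subseteq> plot \<pi> \<and>
      (\<exists>\<alpha> \<beta>.
         order_preserving_injection k n \<alpha> \<and> order_preserving_injection k n \<beta> \<and>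
         \<alpha> 0 = 0 \<and> \<beta> 0 = 0 \<and> \<alpha> (k + 1) = n + 1 \<and> \<beta> (k + 1) = n + 1 \<and>
         \<omega> = {(\<alpha> i, \<beta> j) | i j. (i, j) \<in> plot \<tau>} \<and>
         (\<forall>(i, j) \<in> R. mesh_box \<alpha> \<beta> i j \<inter> plot \<pi> = {})))"

definition avoids :: "nat list \<Rightarrow> mesh_pattern \<Rightarrow> bool" where
  "avoids \<pi> p \<longleftrightarrow> \<not> (\<exists>\<omega>. is_occurrence p \<pi> \<omega>)"

definition classical :: "nat list \<Rightarrow> mesh_pattern" where
  "classical \<tau> = (\<tau>, {})"

definition Av :: "nat \<Rightarrow> mesh_pattern set \<Rightarrow> nat list set" where
  "Av n S = {\<pi> \<in> permutations_of_set {1..n}. \<forall>p \<in> S. avoids \<pi> p}"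

definition Av_gf :: "mesh_pattern set \<Rightarrow> int fps" where
  "Av_gf S = Abs_fps (\<lambda>n. int (card (Av n S)))"

definition m1 :: mesh_pattern where
  "m1 = ([1, 2], {(1, 0), (1, 1), (1, 2), (2, 0), (2, 1)})"

definition m2 :: mesh_pattern where
  "m2 = ([2, 1], {(0, 1), (1, 0), (1, 1), (1, 2), (2, 1)})"

text \<open>
  The usual recurrence \<open>M\<^sub>0 = 1\<close>, \<open>M\<^sub>n\<^sub>+\<^sub>1 = M\<^sub>n + (\<Sum>i + j = n - 1. M\<^sub>i M\<^sub>j)\<close>: a Motzkin path of
  length \<open>n + 1\<close> starts with a level step, or with an up step that is matched by a
  down step after \<open>i\<close> further steps.
\<close>

fun motzkin :: "nat \<Rightarrow> nat" where
  "motzkin 0 = 1"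
| "motzkin (Suc n) = motzkin n + (\<Sum>i<n. motzkin i * motzkin (n - 1 - i))"

lemma is_mesh_pattern_m1: "is_mesh_pattern 2 m1"
  and is_mesh_pattern_m2: "is_mesh_pattern 2 m2"
  and is_mesh_pattern_231: "is_mesh_pattern 3 (classical [2, 3, 1])"
  by (auto simp: is_mesh_pattern_def m1_def m2_def classical_def permutations_of_set_def)

lemma motzkin_values: "map motzkin [0..<7] = [1, 1, 2, 4, 9, 21, 51]"
  by code_simp

end

theory Submission
  imports Defs
begin

text \<open>
  An occurrence of \<^const>\<open>m1\<close> is an ascent at adjacent positions whose top is a right-to-left
  minimum; an occurrence of \<^const>\<open>m2\<close> is a factor \<open>(a + 1) a\<close>. A 231-avoider with first letter
  \<open>a\<close> is \<open>a L R\<close> with \<open>L < a < R\<close>. It avoids \<^const>\<open>m1\<close> iff \<open>L\<close> and \<open>R\<close> do and \<open>R\<close> does not start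
  with its minimum, and it avoids \<^const>\<open>m2\<close> iff \<open>L\<close> and \<open>R\<close> do and \<open>L\<close> does not start with its
  maximum. Let \<open>D\<close> count the avoiders that do not start with their minimum (maximum); those that
  do are obtained by prepending a letter to one that does not. Hence in both cases
  \<open>P = 1 + x P D\<close> and \<open>P = D + x D\<close>, which yields the equation for \<open>P\<close>.
\<close>

section \<open>Avoidance as a condition on lists\<close>

text \<open>The letter \<open>x\<close> plays the 2, \<open>y\<close> the 3 and \<open>z\<close> the
  1; \<open>sorted_wrt\<close> ranges over all pairs in list order, not only adjacent ones.\<close>

fun av231 :: "nat list \<Rightarrow> bool" where
  "av231 [] = True"
| "av231 (x # xs) \<longleftrightarrow> sorted_wrt (\<lambda>y z. \<not> (z < x \<and> x < y)) xs \<and> av231 xs"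

fun no_rlmin_ascent :: "nat list \<Rightarrow> bool" where
  "no_rlmin_ascent (x # y # zs) \<longleftrightarrow>
     \<not> (x < y \<and> (\<forall>z \<in> set zs. y < z)) \<and> no_rlmin_ascent (y # zs)"
| "no_rlmin_ascent _ = True"

definition no_unit_descent :: "nat list \<Rightarrow> bool" where
  "no_unit_descent = successively (\<lambda>x y. x \<noteq> Suc y)"

text \<open>The first letter can only play the 2 of an occurrence; every other occurrence lies in
  the tail, where the induction hypothesis applies.\<close>

lemma av231_conv_nth:
  "av231 xs \<longleftrightarrow>
     \<not> (\<exists>i j k. i < j \<and> j < k \<and> k < length xs \<and> xs ! k < xs ! i \<and> xs ! i < xs ! j)"
proof (induction xs)
  case (Cons x xs)
  have "(\<exists>i j k. i < j \<and> j < k \<and> k < length (x # xs) \<and>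
           (x # xs) ! k < (x # xs) ! i \<and> (x # xs) ! i < (x # xs) ! j) \<longleftrightarrow>
        (\<exists>j k. j < k \<and> k < length xs \<and> xs ! k < x \<and> x < xs ! j) \<or>
        (\<exists>i j k. i < j \<and> j < k \<and> k < length xs \<and> xs ! k < xs ! i \<and> xs ! i < xs ! j)"
    (is "?l \<longleftrightarrow> ?a \<or> ?b")
  proof
    assume ?l
    then obtain i j k where *: "i < j" "j < k" "k < length (x # xs)"
      "(x # xs) ! k < (x # xs) ! i" "(x # xs) ! i < (x # xs) ! j" by blast
    then obtain j' k' where "j = Suc j'" "k = Suc k'"
      by (metis less_imp_Suc_add)
    with * show "?a \<or> ?b" by (cases i) auto
  next
    assume "?a \<or> ?b"
    then show ?l
    proof
      assume ?a
      then obtain j k where "j < k" "k < length xs" "xs ! k < x" "x < xs ! j" by blast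
      then show ?l by (intro exI[of _ 0] exI[of _ "Suc j"] exI[of _ "Suc k"]) auto
    next
      assume ?b
      then obtain i j k where "i < j" "j < k" "k < length xs" "xs ! k < xs ! i" "xs ! i < xs ! j"
        by blast
      then show ?l by (intro exI[of _ "Suc i"] exI[of _ "Suc j"] exI[of _ "Suc k"]) auto
    qed
  qed
  with Cons.IH show ?case by (auto simp: sorted_wrt_iff_nth_less)
qed simp

lemma ex_nat_iff: "(\<exists>i. P i) \<longleftrightarrow> P 0 \<or> (\<exists>i. P (Suc i))"
  by (metis not0_implies_Suc)

text \<open>Whether a letter is a right-to-left minimum depends only on what follows it, so dropping
  the first letter merely shifts the indices of the later ascents.\<close>

lemma no_rlmin_ascent_conv_nth:
  "no_rlmin_ascent xs \<longleftrightarrow>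
     \<not> (\<exists>i. Suc i < length xs \<and> xs ! i < xs ! Suc i \<and>
            (\<forall>j. Suc i < j \<and> j < length xs \<longrightarrow> xs ! Suc i < xs ! j))"
proof (induction xs rule: no_rlmin_ascent.induct)
  case (1 x y zs)
  let ?P = "\<lambda>xs i. Suc i < length xs \<and> xs ! i < xs ! Suc i \<and>
            (\<forall>j. Suc i < j \<and> j < length xs \<longrightarrow> xs ! Suc i < xs ! j)"
  have 0: "?P (x # y # zs) 0 \<longleftrightarrow> x < y \<and> (\<forall>z \<in> set zs. y < z)"
    by (auto simp: set_conv_nth nth_Cons split: nat.splits)
  have S: "?P (x # y # zs) (Suc i) \<longleftrightarrow> ?P (y # zs) i" for i
  proof -
    have "(\<forall>j. Suc (Suc i) < j \<and> j < length (x # y # zs) \<longrightarrow> Q ((x # y # zs) ! j)) \<longleftrightarrow>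
          (\<forall>j. Suc i < j \<and> j < length (y # zs) \<longrightarrow> Q ((y # zs) ! j))" for Q
    proof (intro iffI allI impI)
      fix j assume l: "\<forall>j. Suc (Suc i) < j \<and> j < length (x # y # zs) \<longrightarrow> Q ((x # y # zs) ! j)"
        and j: "Suc i < j \<and> j < length (y # zs)"
      show "Q ((y # zs) ! j)" using l[rule_format, of "Suc j"] j by simp
    next
      fix j assume r: "\<forall>j. Suc i < j \<and> j < length (y # zs) \<longrightarrow> Q ((y # zs) ! j)"
        and j: "Suc (Suc i) < j \<and> j < length (x # y # zs)"
      then obtain j' where "j = Suc j'" by (cases j) auto
      then show "Q ((x # y # zs) ! j)" using r[rule_format, of j'] j by simp
    qed
    from this[of "\<lambda>z. (y # zs) ! Suc i < z"] show ?thesis by simp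
  qed
  have "(\<exists>i. ?P (x # y # zs) i) \<longleftrightarrow> (x < y \<and> (\<forall>z \<in> set zs. y < z)) \<or> (\<exists>i. ?P (y # zs) i)"
    by (subst ex_nat_iff) (simp only: 0 S)
  then show ?case using 1 unfolding no_rlmin_ascent.simps by blast
qed auto

section \<open>Occurrences of the three patterns in terms of positions and values\<close>

lemma mesh_box_plot_empty_iff:
  "mesh_box \<alpha> \<beta> i j \<inter> plot \<pi> = {} \<longleftrightarrow>
     (\<forall>k < length \<pi>. \<not> (\<alpha> i < Suc k \<and> Suc k < \<alpha> (Suc i) \<and> \<beta> j < \<pi> ! k \<and> \<pi> ! k < \<beta> (Suc j)))"
proof -
  have "(Suc k, \<pi> ! k) \<in> mesh_box \<alpha> \<beta> i j \<longleftrightarrow>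
      \<alpha> i < Suc k \<and> Suc k < \<alpha> (Suc i) \<and> \<beta> j < \<pi> ! k \<and> \<pi> ! k < \<beta> (Suc j)" for k
    unfolding mesh_box_def by auto
  then show ?thesis unfolding plot_def by blast
qed

lemma mem_plot_iff: "(a, b) \<in> plot \<pi> \<longleftrightarrow> 1 \<le> a \<and> a \<le> length \<pi> \<and> \<pi> ! (a - 1) = b"
  unfolding plot_def by (cases a) auto

lemma order_preserving_injection_less:
  assumes "order_preserving_injection k n \<alpha>" "i \<in> {1..k}" "j \<in> {1..k}" "i < j"
  shows "\<alpha> i < \<alpha> j"
  using assms unfolding order_preserving_injection_def inj_on_def mono_on_def
  by (metis less_imp_le less_irrefl nless_le)

text \<open>The set \<omega> is determined by \<alpha> and \<beta>, so it can be eliminated, leaving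
  only the requirement that the image points lie in the plot.\<close>

lemma not_avoids_iff:
  "\<not> avoids \<pi> (\<tau>, R) \<longleftrightarrow> (\<exists>\<alpha> \<beta>.
     order_preserving_injection (length \<tau>) (length \<pi>) \<alpha> \<and>
     order_preserving_injection (length \<tau>) (length \<pi>) \<beta> \<and>
     \<alpha> 0 = 0 \<and> \<beta> 0 = 0 \<and> \<alpha> (Suc (length \<tau>)) = Suc (length \<pi>) \<and>
     \<beta> (Suc (length \<tau>)) = Suc (length \<pi>) \<and>
     (\<forall>i < length \<tau>. (\<alpha> (Suc i), \<beta> (\<tau> ! i)) \<in> plot \<pi>) \<and>
     (\<forall>(i, j) \<in> R. \<forall>k < length \<pi>.
        \<not> (\<alpha> i < Suc k \<and> Suc k < \<alpha> (Suc i) \<and> \<beta> j < \<pi> ! k \<and> \<pi> ! k < \<beta> (Suc j))))"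
proof -
  have "{(\<alpha> i, \<beta> j) | i j. (i, j) \<in> plot \<tau>} \<subseteq> plot \<pi> \<longleftrightarrow>
        (\<forall>i < length \<tau>. (\<alpha> (Suc i), \<beta> (\<tau> ! i)) \<in> plot \<pi>)" for \<alpha> \<beta>
    unfolding plot_def[of \<tau>] by blast
  \<comment> \<open>A one-point rule for \<omega>, shaped after the conjuncts in
    \<open>is_occurrence\<close>.\<close>
  moreover have one_point:
    "(\<exists>w. Q w \<and> (\<exists>a b. A a b \<and> B a b \<and> C a b \<and> D a b \<and> E a b \<and> F a b \<and>
        w = S a b \<and> G a b)) \<longleftrightarrow>
      (\<exists>a b. A a b \<and> B a b \<and> C a b \<and> D a b \<and> E a b \<and> F a b \<and> Q (S a b) \<and> G a b)"
    for Q :: "'a \<Rightarrow> bool" and A B C D E F G :: "'b \<Rightarrow> 'c \<Rightarrow> bool" and S by blast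
  ultimately show ?thesis
    by (simp only: avoids_def is_occurrence_def Let_def mesh_box_plot_empty_iff fst_conv snd_conv
        Suc_eq_plus1[symmetric] not_not one_point)
qed

lemma atLeastAtMost_1_3: "{1..3::nat} = {1, 2, 3}" and atLeastAtMost_1_2: "{1..2::nat} = {1, 2}"
  by auto

lemma avoids_classical_231_iff:
  assumes "\<pi> \<in> permutations_of_set {1..n}"
  shows "avoids \<pi> (classical [2, 3, 1]) \<longleftrightarrow> av231 \<pi>"
proof -
  have len: "length \<pi> = n" and set: "set \<pi> = {1..n}"
    using assms length_finite_permutations_of_set permutations_of_setD(1) by fastforce+
  have "\<not> avoids \<pi> (classical [2, 3, 1]) \<longleftrightarrow>
    (\<exists>i j k. i < j \<and> j < k \<and> k < length \<pi> \<and> \<pi> ! k < \<pi> ! i \<and> \<pi> ! i < \<pi> ! j)" (is "_ \<longleftrightarrow> ?r")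
  proof
    assume "\<not> avoids \<pi> (classical [2, 3, 1])"
    then obtain \<alpha> \<beta> where
      *: "order_preserving_injection 3 n \<alpha>" "order_preserving_injection 3 n \<beta>"
      and pts: "\<forall>i < length [2, 3, 1 :: nat]. (\<alpha> (Suc i), \<beta> ([2, 3, 1] ! i)) \<in> plot \<pi>"
      unfolding classical_def not_avoids_iff by (auto simp: len numeral_eq_Suc)
    have "(\<alpha> 1, \<beta> 2) \<in> plot \<pi>" "(\<alpha> 2, \<beta> 3) \<in> plot \<pi>" "(\<alpha> 3, \<beta> 1) \<in> plot \<pi>"
      using pts[rule_format, of 0] pts[rule_format, of 1] pts[rule_format, of 2]
      by (simp_all add: numeral_2_eq_2 numeral_3_eq_3)
    moreover have "\<alpha> 1 < \<alpha> 2" "\<alpha> 2 < \<alpha> 3" "\<beta> 1 < \<beta> 2" "\<beta> 2 < \<beta> 3"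
      using *[THEN order_preserving_injection_less, of 1 2]
        *[THEN order_preserving_injection_less, of 2 3] by auto
    ultimately show ?r
      \<comment> \<open>Positions in the plot count from 1, list indices from 0.\<close>
      by (intro exI[of _ "\<alpha> 1 - 1"] exI[of _ "\<alpha> 2 - 1"] exI[of _ "\<alpha> 3 - 1"])
        (auto simp: mem_plot_iff)
  next
    assume ?r
    then obtain i j k where *: "i < j" "j < k" "k < n" "\<pi> ! k < \<pi> ! i" "\<pi> ! i < \<pi> ! j"
      by (auto simp: len)
    have mem: "\<pi> ! i \<in> {1..n}" "\<pi> ! j \<in> {1..n}" "\<pi> ! k \<in> {1..n}"
      using * len unfolding set[symmetric] by auto
    \<comment> \<open>\<alpha> lists the three positions and \<beta> the three values in increasing
      order; the default \<open>Suc n\<close> supplies the required value at 4.\<close>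
    define \<alpha> where "\<alpha> = (\<lambda>_ :: nat. Suc n)(0 := 0, 1 := Suc i, 2 := Suc j, 3 := Suc k)"
    define \<beta> where "\<beta> = (\<lambda>_ :: nat. Suc n)(0 := 0, 1 := \<pi> ! k, 2 := \<pi> ! i, 3 := \<pi> ! j)"
    have "order_preserving_injection 3 n \<alpha>" "order_preserving_injection 3 n \<beta>"
      using * mem unfolding order_preserving_injection_def \<alpha>_def \<beta>_def atLeastAtMost_1_3
      by (auto simp: mono_on_def)
    then show "\<not> avoids \<pi> (classical [2, 3, 1])"
      unfolding classical_def not_avoids_iff using *
      by (intro exI[of _ \<alpha>] exI[of _ \<beta>])
        (auto simp: len \<alpha>_def \<beta>_def mem_plot_iff less_Suc_eq numeral_3_eq_3 numeral_2_eq_2)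
  qed
  then show ?thesis using av231_conv_nth by blast
qed

text \<open>The fully shaded middle column forces the two positions to be adjacent; the boxes (2,0)
  and (2,1) leave nothing below the top letter to its right.\<close>

lemma avoids_m1_iff:
  assumes "\<pi> \<in> permutations_of_set {1..n}"
  shows "avoids \<pi> m1 \<longleftrightarrow> no_rlmin_ascent \<pi>"
proof -
  have len: "length \<pi> = n" and set: "set \<pi> = {1..n}" and dist: "distinct \<pi>"
    using assms length_finite_permutations_of_set permutations_of_setD by fastforce+
  have mem: "1 \<le> \<pi> ! k" "\<pi> ! k \<le> n" if "k < n" for k
    using that len nth_mem[of k \<pi>] unfolding set by auto
  have "\<not> avoids \<pi> m1 \<longleftrightarrow> (\<exists>i. Suc i < length \<pi> \<and> \<pi> ! i < \<pi> ! Suc i \<and>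
            (\<forall>j. Suc i < j \<and> j < length \<pi> \<longrightarrow> \<pi> ! Suc i < \<pi> ! j))" (is "_ \<longleftrightarrow> ?r")
  proof
    assume "\<not> avoids \<pi> m1"
    then obtain \<alpha> \<beta> where
      *: "order_preserving_injection 2 n \<alpha>" "order_preserving_injection 2 n \<beta>"
      and ends: "\<alpha> 0 = 0" "\<beta> 0 = 0" "\<alpha> 3 = Suc n" "\<beta> 3 = Suc n"
      and pts: "\<forall>i < length [1, 2 :: nat]. (\<alpha> (Suc i), \<beta> ([1, 2] ! i)) \<in> plot \<pi>"
      and boxes: "\<forall>(i, j) \<in> snd m1. \<forall>k < n.
        \<not> (\<alpha> i < Suc k \<and> Suc k < \<alpha> (Suc i) \<and> \<beta> j < \<pi> ! k \<and> \<pi> ! k < \<beta> (Suc j))"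
      unfolding m1_def not_avoids_iff by (auto simp: len numeral_eq_Suc)
    have pts: "(\<alpha> 1, \<beta> 1) \<in> plot \<pi>" "(\<alpha> 2, \<beta> 2) \<in> plot \<pi>"
      using pts[rule_format, of 0] pts[rule_format, of 1] by (simp_all add: numeral_2_eq_2)
    have less: "\<alpha> 1 < \<alpha> 2" "\<beta> 1 < \<beta> 2"
      using *[THEN order_preserving_injection_less, of 1 2] by auto
    from pts obtain i j where ij: "\<alpha> 1 = Suc i" "\<alpha> 2 = Suc j" "i < n" "j < n"
      "\<beta> 1 = \<pi> ! i" "\<beta> 2 = \<pi> ! j"
      unfolding plot_def len by auto
    \<comment> \<open>By injectivity no other letter lies on a horizontal grid line, so it falls
      into the interior of some box.\<close>
    have ne: "\<pi> ! k \<noteq> \<pi> ! i" "\<pi> ! k \<noteq> \<pi> ! j" if "k < n" "k \<noteq> i" "k \<noteq> j" for k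
      using that ij dist len by (auto simp: nth_eq_iff_index_eq)
    note ij' = ij[unfolded One_nat_def] ij[unfolded numeral_2_eq_2]
    \<comment> \<open>The shaded boxes in the order (1,0), (1,1), (1,2), (2,0), (2,1); bounds by 0
      and \<open>Suc n\<close> hold for every letter and disappear.\<close>
    have box: "\<not> (i < k \<and> k < j \<and> \<pi> ! k < \<pi> ! i)"
      "\<not> (i < k \<and> k < j \<and> \<pi> ! i < \<pi> ! k \<and> \<pi> ! k < \<pi> ! j)"
      "\<not> (i < k \<and> k < j \<and> \<pi> ! j < \<pi> ! k)"
      "\<not> (j < k \<and> \<pi> ! k < \<pi> ! i)"
      "\<not> (j < k \<and> \<pi> ! i < \<pi> ! k \<and> \<pi> ! k < \<pi> ! j)" if "k < n" for k
      using boxes that mem[OF that] unfolding m1_def by (auto simp: ij' ends)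
    have "j = Suc i"
    proof (rule ccontr)
      assume "j \<noteq> Suc i"
      then have "i < Suc i" "Suc i < j" "Suc i < n" using less ij by auto
      \<comment> \<open>The letter right after position \<open>i\<close> would lie in one of the
        three boxes of the middle column.\<close>
      then show False using box[of "Suc i"] ne[of "Suc i"] by auto
    qed
    moreover have "\<pi> ! j < \<pi> ! k" if "j < k" "k < n" for k
    proof -
      have "\<pi> ! k \<noteq> \<pi> ! i" "\<pi> ! k \<noteq> \<pi> ! j" using ne[of k] that less ij by auto
      moreover have "\<not> \<pi> ! k < \<pi> ! i" "\<not> (\<pi> ! i < \<pi> ! k \<and> \<pi> ! k < \<pi> ! j)"
        using box(4,5)[of k] that by blast+
      ultimately show ?thesis by linarith
    qed
    ultimately show ?r using less ij len by auto
  next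
    assume ?r
    then obtain i where *: "Suc i < n" "\<pi> ! i < \<pi> ! Suc i"
      and min: "\<And>k. Suc i < k \<Longrightarrow> k < n \<Longrightarrow> \<pi> ! Suc i < \<pi> ! k" by (auto simp: len)
    have above: "\<not> \<pi> ! k < \<pi> ! Suc i" "\<not> \<pi> ! k < \<pi> ! i" if "Suc i < k" "k < n" for k
      using min[OF that] * by auto
    \<comment> \<open>The default \<open>Suc n\<close> supplies the boundary value at 3.\<close>
    define \<alpha> where "\<alpha> = (\<lambda>_ :: nat. Suc n)(0 := 0, 1 := Suc i, 2 := Suc (Suc i))"
    define \<beta> where "\<beta> = (\<lambda>_ :: nat. Suc n)(0 := 0, 1 := \<pi> ! i, 2 := \<pi> ! Suc i)"
    have "order_preserving_injection 2 n \<alpha>" "order_preserving_injection 2 n \<beta>"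
      using * mem[of i] mem[of "Suc i"]
      unfolding order_preserving_injection_def \<alpha>_def \<beta>_def atLeastAtMost_1_2
      by (auto simp: mono_on_def)
    then show "\<not> avoids \<pi> m1"
      unfolding m1_def not_avoids_iff using *
      by (intro exI[of _ \<alpha>] exI[of _ \<beta>])
        (auto simp: above len \<alpha>_def \<beta>_def mem_plot_iff less_Suc_eq numeral_2_eq_2)
  qed
  then show ?thesis using no_rlmin_ascent_conv_nth by blast
qed

text \<open>The shading is a cross: the empty middle column makes the positions adjacent, and the
  empty middle row makes the values consecutive because every value in \<open>{1..n}\<close> is
  taken.\<close>

lemma avoids_m2_iff:
  assumes "\<pi> \<in> permutations_of_set {1..n}"
  shows "avoids \<pi> m2 \<longleftrightarrow> no_unit_descent \<pi>"
proof -
  have len: "length \<pi> = n" and set: "set \<pi> = {1..n}" and dist: "distinct \<pi>"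
    using assms length_finite_permutations_of_set permutations_of_setD by fastforce+
  have mem: "1 \<le> \<pi> ! k" "\<pi> ! k \<le> n" if "k < n" for k
    using that len nth_mem[of k \<pi>] unfolding set by auto
  have "\<not> avoids \<pi> m2 \<longleftrightarrow> (\<exists>i. Suc i < length \<pi> \<and> \<pi> ! i = Suc (\<pi> ! Suc i))" (is "_ \<longleftrightarrow> ?r")
  proof
    assume "\<not> avoids \<pi> m2"
    then obtain \<alpha> \<beta> where
      *: "order_preserving_injection 2 n \<alpha>" "order_preserving_injection 2 n \<beta>"
      and ends: "\<alpha> 0 = 0" "\<beta> 0 = 0" "\<alpha> 3 = Suc n" "\<beta> 3 = Suc n"
      and pts: "\<forall>i < length [2, 1 :: nat]. (\<alpha> (Suc i), \<beta> ([2, 1] ! i)) \<in> plot \<pi>"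
      and boxes: "\<forall>(i, j) \<in> snd m2. \<forall>k < n.
        \<not> (\<alpha> i < Suc k \<and> Suc k < \<alpha> (Suc i) \<and> \<beta> j < \<pi> ! k \<and> \<pi> ! k < \<beta> (Suc j))"
      unfolding m2_def not_avoids_iff by (auto simp: len numeral_eq_Suc)
    have pts: "(\<alpha> 1, \<beta> 2) \<in> plot \<pi>" "(\<alpha> 2, \<beta> 1) \<in> plot \<pi>"
      using pts[rule_format, of 0] pts[rule_format, of 1] by (simp_all add: numeral_2_eq_2)
    have less: "\<alpha> 1 < \<alpha> 2" "\<beta> 1 < \<beta> 2"
      using *[THEN order_preserving_injection_less, of 1 2] by auto
    from pts obtain i j where ij: "\<alpha> 1 = Suc i" "\<alpha> 2 = Suc j" "i < n" "j < n"
      "\<beta> 2 = \<pi> ! i" "\<beta> 1 = \<pi> ! j"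
      unfolding plot_def len by auto
    have ne: "\<pi> ! k \<noteq> \<pi> ! i" "\<pi> ! k \<noteq> \<pi> ! j" if "k < n" "k \<noteq> i" "k \<noteq> j" for k
      using that ij dist len by (auto simp: nth_eq_iff_index_eq)
    note ij' = ij[unfolded One_nat_def] ij[unfolded numeral_2_eq_2]
    \<comment> \<open>The shaded boxes in the order (0,1), (1,0), (1,1), (1,2), (2,1).\<close>
    have box: "\<not> (k < i \<and> \<pi> ! j < \<pi> ! k \<and> \<pi> ! k < \<pi> ! i)"
      "\<not> (i < k \<and> k < j \<and> \<pi> ! k < \<pi> ! j)"
      "\<not> (i < k \<and> k < j \<and> \<pi> ! j < \<pi> ! k \<and> \<pi> ! k < \<pi> ! i)"
      "\<not> (i < k \<and> k < j \<and> \<pi> ! i < \<pi> ! k)"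
      "\<not> (j < k \<and> \<pi> ! j < \<pi> ! k \<and> \<pi> ! k < \<pi> ! i)" if "k < n" for k
      using boxes that mem[OF that] unfolding m2_def by (auto simp: ij' ends)
    have "j = Suc i"
    proof (rule ccontr)
      assume "j \<noteq> Suc i"
      then have "i < Suc i" "Suc i < j" "Suc i < n" using less ij by auto
      then show False using box[of "Suc i"] ne[of "Suc i"] by auto
    qed
    moreover have "\<pi> ! i = Suc (\<pi> ! j)"
    proof (rule ccontr)
      assume "\<pi> ! i \<noteq> Suc (\<pi> ! j)"
      then have between: "\<pi> ! j < Suc (\<pi> ! j)" "Suc (\<pi> ! j) < \<pi> ! i" using less ij by auto
      \<comment> \<open>The skipped value occurs somewhere, and whether it is left of, between or
        right of the two points, it falls into a shaded box of the middle row.\<close>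
      then have "Suc (\<pi> ! j) \<in> set \<pi>" using mem[of i] ij unfolding set by auto
      then obtain k where "k < n" "\<pi> ! k = Suc (\<pi> ! j)" unfolding in_set_conv_nth len by blast
      then show False
        using box[of k] between by (metis linorder_neqE_nat less_irrefl)
    qed
    ultimately show ?r using ij len by auto
  next
    assume ?r
    then obtain i where *: "Suc i < n" "\<pi> ! i = Suc (\<pi> ! Suc i)" by (auto simp: len)
    define \<alpha> where "\<alpha> = (\<lambda>_ :: nat. Suc n)(0 := 0, 1 := Suc i, 2 := Suc (Suc i))"
    define \<beta> where "\<beta> = (\<lambda>_ :: nat. Suc n)(0 := 0, 1 := \<pi> ! Suc i, 2 := \<pi> ! i)"
    have "order_preserving_injection 2 n \<alpha>" "order_preserving_injection 2 n \<beta>"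
      using * mem[of i] mem[of "Suc i"]
      unfolding order_preserving_injection_def \<alpha>_def \<beta>_def atLeastAtMost_1_2
      by (auto simp: mono_on_def)
    then show "\<not> avoids \<pi> m2"
      unfolding m2_def not_avoids_iff using *
      by (intro exI[of _ \<alpha>] exI[of _ \<beta>])
        (force simp: len \<alpha>_def \<beta>_def mem_plot_iff less_Suc_eq numeral_2_eq_2)
  qed
  then show ?thesis unfolding no_unit_descent_def successively_conv_nth by blast
qed

section \<open>Decomposition by the first letter\<close>

text \<open>Both blocks are kept as permutations of initial segments: \<open>L\<close> fills the
  values below the first letter as it stands, and \<open>R\<close> is shifted above it.\<close>

definition glue :: "nat list \<Rightarrow> nat list \<Rightarrow> nat list" where
  "glue L R = Suc (length L) # L @ map ((+) (Suc (length L))) R"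

text \<open>With \<open>x\<close> as the 2, a letter above \<open>x\<close> can only be followed by
  letters above \<open>x\<close>; so all small letters come first.\<close>

lemma filter_append_filter_eq:
  assumes "sorted_wrt (\<lambda>y z. \<not> (z < x \<and> x < y)) xs" "x \<notin> set xs"
  shows "filter (\<lambda>y. y < x) xs @ filter (\<lambda>y. x < y) xs = (xs :: nat list)"
  using assms
proof (induction xs)
  case (Cons y ys)
  show ?case
  proof (cases "y < x")
    case False
    then have "\<forall>z \<in> set ys. x < z" using Cons.prems by (fastforce simp: not_less le_less)
    then have "filter (\<lambda>y. y < x) ys = []" "filter (\<lambda>y. x < y) ys = ys"
      by (auto simp: filter_empty_conv)
    then show ?thesis using False Cons.prems by auto
  qed (use Cons in auto)
qed simp

lemma sorted_wrt_if_all: "(\<And>x y. x \<in> set xs \<Longrightarrow> y \<in> set xs \<Longrightarrow> P x y) \<Longrightarrow> sorted_wrt P xs"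
  by (induction xs) auto

text \<open>An occurrence with its 2 in \<open>L\<close> has its smaller 1 in \<open>L\<close> too,
  hence also the 3 between them; otherwise it lies wholly in \<open>R\<close>.\<close>

lemma av231_append:
  assumes "\<forall>x \<in> set L. \<forall>y \<in> set R. x < y"
  shows "av231 (L @ R) \<longleftrightarrow> av231 L \<and> av231 R"
  using assms
proof (induction L)
  case (Cons x L)
  have "\<forall>y \<in> set R. \<not> y < x" using Cons.prems by (simp add: less_imp_le not_less)
  then have "sorted_wrt (\<lambda>y z. \<not> (z < x \<and> x < y)) R"
    by (intro sorted_wrt_if_all) blast
  then show ?case using Cons by (auto simp: sorted_wrt_append)
qed simp

lemma av231_map_add: "av231 (map ((+) c) xs) \<longleftrightarrow> av231 xs"
  by (induction xs) (auto simp: sorted_wrt_map)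

lemma av231_glue:
  assumes "L \<in> permutations_of_set {1..i}" "R \<in> permutations_of_set {1..j}"
  shows "av231 (glue L R) \<longleftrightarrow> av231 L \<and> av231 R"
proof -
  have L: "set L = {1..i}" "length L = i" and R: "set R = {1..j}"
    using assms length_finite_permutations_of_set[of L "{1..i}"] permutations_of_setD(1) by auto
  let ?xs = "L @ map ((+) (Suc i)) R"
  have "sorted_wrt (\<lambda>y z. \<not> (z < Suc i \<and> Suc i < y)) ?xs"
    unfolding sorted_wrt_append using L R
    by (intro conjI sorted_wrt_if_all) auto
  moreover have "\<forall>x \<in> set L. \<forall>y \<in> set (map ((+) (Suc i)) R). x < y"
    using L R by auto
  ultimately show ?thesis by (simp add: glue_def L av231_append av231_map_add del: map_map)
qed

lemma glue_in_permutations: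
  assumes "L \<in> permutations_of_set {1..i}" "R \<in> permutations_of_set {1..n - i}" "i \<le> n"
  shows "glue L R \<in> permutations_of_set {1..Suc n}"
proof -
  have L: "set L = {1..i}" "length L = i" "distinct L" and R: "set R = {1..n - i}" "distinct R"
    using assms length_finite_permutations_of_set[of L "{1..i}"] permutations_of_setD by auto
  have "(+) (Suc i) ` {1..n - i} = {1 + Suc i..n - i + Suc i}"
    by (simp only: image_add_atLeastAtMost add.commute)
  then have *: "set (map ((+) (Suc i)) R) = {Suc (Suc i)..Suc n}"
    using R \<open>i \<le> n\<close> by simp
  then show ?thesis
    using L R \<open>i \<le> n\<close> unfolding permutations_of_set_def glue_def
    by (auto simp: distinct_map simp del: set_map)
qed

text \<open>The first letter reveals the length of \<open>L\<close>, hence the cut, and the shift of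
  \<open>R\<close> is injective.\<close>

lemma glue_inject:
  "glue L R = glue L' R' \<longleftrightarrow> L = L' \<and> R = R'"
  unfolding glue_def by (auto simp: inj_map_eq_map)

text \<open>Split the tail into the letters below and above the first letter; avoidance of 231
  guarantees that they form two consecutive blocks.\<close>

lemma glue_surj:
  assumes "\<pi> \<in> permutations_of_set {1..Suc n}" "av231 \<pi>"
  obtains i L R where "i \<le> n" "L \<in> permutations_of_set {1..i}"
    "R \<in> permutations_of_set {1..n - i}" "\<pi> = glue L R"
proof -
  have \<pi>: "set \<pi> = {1..Suc n}" "distinct \<pi>" using assms permutations_of_setD by auto
  then obtain x xs where xs: "\<pi> = x # xs" by (cases \<pi>) auto
  define i where "i = x - 1"
  have "x \<in> {1..Suc n}" unfolding \<pi>(1)[symmetric] by (simp add: xs)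
  then have x: "x = Suc i" and i: "i \<le> n" unfolding i_def by auto
  have set_xs: "set xs = {1..Suc n} - {x}" using \<pi> xs by auto
  define L where "L = filter (\<lambda>y. y < x) xs"
  define R where "R = map (\<lambda>y. y - x) (filter (\<lambda>y. x < y) xs)"
  have L: "set L = {1..i}" "distinct L" unfolding L_def using set_xs x i \<pi> xs by auto
  have "(\<lambda>y. y - x) ` {x<..Suc n} = {1..n - i}"
  proof
    show "{1..n - i} \<subseteq> (\<lambda>y. y - x) ` {x<..Suc n}"
    proof
      fix z assume "z \<in> {1..n - i}"
      then show "z \<in> (\<lambda>y. y - x) ` {x<..Suc n}"
        using x i by (intro image_eqI[of _ _ "z + x"]) auto
    qed
  qed (use x i in auto)
  moreover have "{x<..Suc n} = {y \<in> set xs. x < y}" unfolding set_xs by auto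
  ultimately have "set R = {1..n - i}" unfolding R_def set_map set_filter by simp
  moreover have "distinct R"
    using \<pi>(2) unfolding R_def xs by (auto simp: distinct_map inj_on_def)
  ultimately have R_perm: "R \<in> permutations_of_set {1..n - i}" by (rule permutations_of_setI)
  have L_perm: "L \<in> permutations_of_set {1..i}" using L by (rule permutations_of_setI)
  have "\<pi> = glue L R"
  proof -
    have "length L = i" using length_finite_permutations_of_set[OF L_perm] by simp
    moreover have "map ((+) x) R = filter (\<lambda>y. x < y) xs"
      unfolding R_def by (auto intro!: map_idI)
    moreover have "L @ filter (\<lambda>y. x < y) xs = xs"
      using assms(2) \<pi> unfolding xs L_def by (intro filter_append_filter_eq) auto
    ultimately show ?thesis by (simp add: glue_def xs x del: add_Suc)
  qed
  then show ?thesis by (rule that[OF i L_perm R_perm])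
qed

section \<open>Counting 231-avoiders by convolution\<close>

definition perms231 :: "(nat list \<Rightarrow> bool) \<Rightarrow> nat \<Rightarrow> nat list set" where
  "perms231 Q n = {\<pi> \<in> permutations_of_set {1..n}. av231 \<pi> \<and> Q \<pi>}"

lemma finite_perms231 [simp]: "finite (perms231 Q n)"
  unfolding perms231_def by simp

text \<open>\<open>glue\<close> is a bijection from pairs of smaller avoiders. Allowing separate
  conditions \<open>E\<close> and \<open>F\<close> lets one recurrence serve the full classes and
  the classes restricted by their first letter.\<close>

lemma card_perms231_Suc:
  assumes "\<And>i j L R. L \<in> permutations_of_set {1..i} \<Longrightarrow> R \<in> permutations_of_set {1..j} \<Longrightarrow>
    Q (glue L R) \<longleftrightarrow> E L \<and> F R"
  shows "card (perms231 Q (Suc n)) = (\<Sum>i\<le>n. card (perms231 E i) * card (perms231 F (n - i)))"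
proof -
  let ?g = "\<lambda>(i :: nat, L, R). glue L R"
  let ?S = "SIGMA i : {..n}. perms231 E i \<times> perms231 F (n - i)"
  have "bij_betw ?g ?S (perms231 Q (Suc n))"
  proof (rule bij_betw_imageI)
    \<comment> \<open>The summation index is recovered from \<open>L\<close>, so injectivity of
      \<open>glue\<close> extends to the triples.\<close>
    have len: "length L = i" if "L \<in> perms231 E i" for L i
      using that length_finite_permutations_of_set[of L "{1..i}"] unfolding perms231_def by simp
    show "inj_on ?g ?S" by (auto simp: inj_on_def glue_inject dest: len)
    show "?g ` ?S = perms231 Q (Suc n)"
    proof (intro equalityI subsetI)
      fix \<pi> assume "\<pi> \<in> ?g ` ?S"
      then show "\<pi> \<in> perms231 Q (Suc n)"
        by (auto simp: perms231_def av231_glue assms glue_in_permutations simp del: One_nat_def)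
    next
      fix \<pi> assume \<pi>: "\<pi> \<in> perms231 Q (Suc n)"
      then obtain i L R where *: "i \<le> n" "L \<in> permutations_of_set {1..i}"
        "R \<in> permutations_of_set {1..n - i}" "\<pi> = glue L R"
        unfolding perms231_def using glue_surj by blast
      with \<pi> have "(i, L, R) \<in> ?S"
        unfolding perms231_def by (auto simp: av231_glue assms)
      with * show "\<pi> \<in> ?g ` ?S" by force
    qed
  qed
  then show ?thesis
    by (simp add: bij_betw_same_card[symmetric] card_cartesian_product)
qed

section \<open>The two mesh conditions under the decomposition\<close>

lemma no_rlmin_ascent_map_add: "no_rlmin_ascent (map ((+) c) xs) \<longleftrightarrow> no_rlmin_ascent xs"
  by (induction xs rule: no_rlmin_ascent.induct) auto

text \<open>Larger letters to the right do not affect the right-to-left minima of \<open>L\<close>.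
  The only new adjacent pair is the ascent at the junction, with top \<open>hd R\<close>.\<close>

lemma no_rlmin_ascent_append:
  assumes "\<forall>x \<in> set L. \<forall>y \<in> set R. x < y" "L \<noteq> []" "R \<noteq> []"
  shows "no_rlmin_ascent (L @ R) \<longleftrightarrow>
    no_rlmin_ascent L \<and> no_rlmin_ascent R \<and> \<not> (\<forall>z \<in> set (tl R). hd R < z)"
  using assms
proof (induction L rule: no_rlmin_ascent.induct)
  \<comment> \<open>With a single letter left, the junction itself is the front pair.\<close>
  case ("2_2" x)
  then show ?case by (cases R) auto
qed auto

text \<open>The empty permutation is counted as not starting with its minimum, which gives the
  series of non-starters constant term 1; likewise for \<open>starts_max\<close>.\<close>

definition starts_min :: "nat list \<Rightarrow> bool" where
  "starts_min xs \<longleftrightarrow> xs \<noteq> [] \<and> hd xs = 1"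

definition starts_max :: "nat list \<Rightarrow> bool" where
  "starts_max xs \<longleftrightarrow> xs \<noteq> [] \<and> hd xs = length xs"

lemma starts_min_iff:
  assumes "R \<in> permutations_of_set {1..j}" "R \<noteq> []"
  shows "starts_min R \<longleftrightarrow> (\<forall>z \<in> set (tl R). hd R < z)"
proof -
  obtain x xs where xs: "R = x # xs" using assms by (cases R) auto
  have R: "set R = {1..j}" "distinct R" using assms permutations_of_setD by auto
  have ge: "z \<ge> 1" if "z \<in> set R" for z using that R by simp
  have "x \<in> {1..j}" unfolding R(1)[symmetric] by (simp add: xs)
  then have 1: "1 \<in> set R" unfolding R(1) by auto
  show ?thesis
  proof
    assume "starts_min R"
    then have "x = 1" by (simp add: starts_min_def xs)
    moreover have "z \<ge> 1 \<and> z \<noteq> x" if "z \<in> set xs" for z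
      using that ge[of z] R(2) xs by auto
    ultimately have "x < z" if "z \<in> set xs" for z
      using that by (metis le_neq_implies_less)
    then show "\<forall>z \<in> set (tl R). hd R < z" by (simp add: xs)
  next
    assume "\<forall>z \<in> set (tl R). hd R < z"
    then show "starts_min R" using 1 ge[of x] by (auto simp: starts_min_def xs)
  qed
qed

text \<open>The step from the first letter into \<open>L\<close> is a descent and harmless, so only
  the junction before \<open>R\<close> adds a condition.\<close>

lemma no_rlmin_ascent_glue:
  assumes "L \<in> permutations_of_set {1..i}" "R \<in> permutations_of_set {1..j}"
  shows "no_rlmin_ascent (glue L R) \<longleftrightarrow> no_rlmin_ascent L \<and> no_rlmin_ascent R \<and> \<not> starts_min R"
proof -
  have L: "set L = {1..i}" "length L = i" and R: "set R = {1..j}"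
    using assms length_finite_permutations_of_set[of L "{1..i}"] permutations_of_setD(1) by auto
  have *: "no_rlmin_ascent (Suc i # L) \<longleftrightarrow> no_rlmin_ascent L"
  proof -
    have "\<forall>x \<in> set L. x \<le> i" using L by simp
    then show ?thesis by (cases L) auto
  qed
  show ?thesis
  proof (cases "R = []")
    case True
    then show ?thesis using * by (simp add: glue_def L starts_min_def)
  next
    case False
    let ?R = "map ((+) (Suc i)) R"
    \<comment> \<open>The left block includes the first letter, so it is nonempty even when
      \<open>L\<close> is empty.\<close>
    have "no_rlmin_ascent ((Suc i # L) @ ?R) \<longleftrightarrow> no_rlmin_ascent (Suc i # L) \<and>
        no_rlmin_ascent ?R \<and> \<not> (\<forall>z \<in> set (tl ?R). hd ?R < z)"
      using L R False by (intro no_rlmin_ascent_append) auto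
    also have "(\<forall>z \<in> set (tl ?R). hd ?R < z) \<longleftrightarrow> starts_min R"
      unfolding starts_min_iff[OF assms(2) False] using False by (auto simp: map_tl[symmetric] hd_map)
    finally show ?thesis
      unfolding glue_def L(2) * no_rlmin_ascent_map_add append_Cons by blast
  qed
qed

lemma no_unit_descent_map_add: "no_unit_descent (map ((+) c) xs) \<longleftrightarrow> no_unit_descent xs"
  unfolding no_unit_descent_def by (simp add: successively_map)

text \<open>The first letter exceeds the maximum of \<open>L\<close> by one, so it forms a unit
  descent exactly with a leading maximum.\<close>

lemma no_unit_descent_glue:
  assumes "L \<in> permutations_of_set {1..i}" "R \<in> permutations_of_set {1..j}"
  shows "no_unit_descent (glue L R) \<longleftrightarrow> (no_unit_descent L \<and> \<not> starts_max L) \<and> no_unit_descent R"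
proof -
  have L: "set L = {1..i}" "length L = i" and R: "set R = {1..j}"
    using assms length_finite_permutations_of_set[of L "{1..i}"] permutations_of_setD(1) by auto
  let ?R = "map ((+) (Suc i)) R"
  have "no_unit_descent (Suc i # L) \<longleftrightarrow> no_unit_descent L \<and> \<not> starts_max L"
    using L by (cases L) (auto simp: no_unit_descent_def starts_max_def)
  \<comment> \<open>The junction before \<open>R\<close> is an ascent.\<close>
  moreover have "last (Suc i # L) \<noteq> Suc (hd ?R)" if "R \<noteq> []"
    using that L last_in_set[of "Suc i # L"] by (auto simp: hd_map simp del: last_in_set)
  then have "no_unit_descent ((Suc i # L) @ ?R) \<longleftrightarrow> no_unit_descent (Suc i # L) \<and> no_unit_descent ?R"
    unfolding no_unit_descent_def successively_append_iff by auto
  ultimately show ?thesis by (simp add: glue_def L no_unit_descent_map_add)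
qed

lemma starts_min_glue: "starts_min (glue L R) \<longleftrightarrow> L = []"
  by (simp add: starts_min_def glue_def)

lemma starts_max_glue: "starts_max (glue L R) \<longleftrightarrow> R = []"
  by (simp add: starts_max_def glue_def)

section \<open>Generating functions\<close>

lemma perms231_Nil: "perms231 (\<lambda>\<pi>. \<pi> = []) n = (if n = 0 then {[]} else {})"
  unfolding perms231_def permutations_of_set_def by auto

lemma perms231_0: "Q [] \<Longrightarrow> perms231 Q 0 = {[]}"
  unfolding perms231_def permutations_of_set_def by auto

lemma card_perms231_split:
  "card (perms231 Q n) = card (perms231 (\<lambda>\<pi>. Q \<pi> \<and> S \<pi>) n) + card (perms231 (\<lambda>\<pi>. Q \<pi> \<and> \<not> S \<pi>) n)"
proof -
  have "perms231 Q n = perms231 (\<lambda>\<pi>. Q \<pi> \<and> S \<pi>) n \<union> perms231 (\<lambda>\<pi>. Q \<pi> \<and> \<not> S \<pi>) n"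
    unfolding perms231_def by auto
  moreover have "perms231 (\<lambda>\<pi>. Q \<pi> \<and> S \<pi>) n \<inter> perms231 (\<lambda>\<pi>. Q \<pi> \<and> \<not> S \<pi>) n = {}"
    unfolding perms231_def by auto
  ultimately show ?thesis by (simp add: card_Un_disjoint)
qed

text \<open>The recurrences say P = 1 + x P D and P = (1 + x) D; multiplying the first by 1 + x
  turns the factor D into P.\<close>

lemma gf_equation:
  fixes a d :: "nat \<Rightarrow> nat"
  assumes "a 0 = 1" "d 0 = 1"
    and a: "\<And>n. a (Suc n) = (\<Sum>i\<le>n. a i * d (n - i))"
    and d: "\<And>n. a (Suc n) = d n + d (Suc n)"
  defines "P \<equiv> Abs_fps (\<lambda>n. int (a n))"
  shows "P = fps_X * P ^ 2 - fps_X * (P - 1) + 1"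
proof -
  define D where "D = Abs_fps (\<lambda>n. int (d n))"
  have nth [simp]: "fps_nth P n = int (a n)" "fps_nth D n = int (d n)" for n
    by (simp_all add: P_def D_def)
  have PD: "fps_nth (P * D) n = int (a (Suc n))" for n
    by (simp add: fps_mult_nth a atLeast0AtMost)
  have 1: "P = 1 + fps_X * (P * D)"
  proof (rule fps_ext)
    fix n show "fps_nth P n = fps_nth (1 + fps_X * (P * D)) n"
      unfolding fps_add_nth fps_X_mult_nth PD by (cases n) (simp_all add: assms(1))
  qed
  have 2: "P = D + fps_X * D"
  proof (rule fps_ext)
    fix n show "fps_nth P n = fps_nth (D + fps_X * D) n"
      by (cases n) (simp_all add: assms(1,2) d)
  qed
  have "(1 + fps_X) * P = (1 + fps_X) + fps_X * P * (D + fps_X * D)"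
    using arg_cong[OF 1, of "\<lambda>F. (1 + fps_X) * F"] by (simp add: algebra_simps)
  then show ?thesis unfolding 2[symmetric] by (simp add: algebra_simps power2_eq_square)
qed

lemma Av_m1: "Av n {classical [2, 3, 1], m1} = perms231 no_rlmin_ascent n"
  unfolding Av_def perms231_def by (auto simp: avoids_classical_231_iff avoids_m1_iff simp del: One_nat_def)

lemma Av_m2: "Av n {classical [2, 3, 1], m2} = perms231 no_unit_descent n"
  unfolding Av_def perms231_def by (auto simp: avoids_classical_231_iff avoids_m2_iff simp del: One_nat_def)

lemma gf_m1:
  defines "P \<equiv> Av_gf {classical [2, 3, 1], m1}"
  shows "P = fps_X * P ^ 2 - fps_X * (P - 1) + 1"
  unfolding P_def Av_gf_def Av_m1
proof (rule gf_equation)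
  let ?d = "\<lambda>n. card (perms231 (\<lambda>\<pi>. no_rlmin_ascent \<pi> \<and> \<not> starts_min \<pi>) n)"
  show "card (perms231 no_rlmin_ascent 0) = 1" "?d 0 = 1"
    by (simp_all add: perms231_0 starts_min_def)
  fix n
  show "card (perms231 no_rlmin_ascent (Suc n)) =
      (\<Sum>i\<le>n. card (perms231 no_rlmin_ascent i) * ?d (n - i))"
    by (rule card_perms231_Suc) (simp add: no_rlmin_ascent_glue)
  \<comment> \<open>Starting with the minimum means that \<open>L\<close> is empty, so only the term
    \<open>i = 0\<close> survives, with \<open>R\<close> not starting with its minimum.\<close>
  have "card (perms231 (\<lambda>\<pi>. no_rlmin_ascent \<pi> \<and> starts_min \<pi>) (Suc n)) =
      (\<Sum>i\<le>n. card (perms231 (\<lambda>\<pi>. \<pi> = []) i) * ?d (n - i))"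
    by (rule card_perms231_Suc) (auto simp: no_rlmin_ascent_glue starts_min_glue)
  also have "\<dots> = (\<Sum>i\<le>n. if i = 0 then ?d n else 0)"
    by (intro sum.cong) (auto simp: perms231_Nil)
  finally show "card (perms231 no_rlmin_ascent (Suc n)) = ?d n + ?d (Suc n)"
    by (subst card_perms231_split[where S = starts_min]) simp
qed

lemma gf_m2:
  defines "P \<equiv> Av_gf {classical [2, 3, 1], m2}"
  shows "P = fps_X * P ^ 2 - fps_X * (P - 1) + 1"
  unfolding P_def Av_gf_def Av_m2
proof (rule gf_equation)
  let ?d = "\<lambda>n. card (perms231 (\<lambda>\<pi>. no_unit_descent \<pi> \<and> \<not> starts_max \<pi>) n)"
  show "card (perms231 no_unit_descent 0) = 1" "?d 0 = 1"
    by (simp_all add: perms231_0 starts_max_def no_unit_descent_def)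
  fix n
  have "card (perms231 no_unit_descent (Suc n)) =
      (\<Sum>i\<le>n. ?d i * card (perms231 no_unit_descent (n - i)))"
    by (rule card_perms231_Suc) (simp add: no_unit_descent_glue)
  \<comment> \<open>Here the restricted factor is the left block, so the sum is reversed to the
    common form.\<close>
  also have "\<dots> = (\<Sum>i\<le>n. card (perms231 no_unit_descent i) * ?d (n - i))"
    by (rule sum.reindex_bij_witness[of _ "\<lambda>i. n - i" "\<lambda>i. n - i"]) auto
  finally show "card (perms231 no_unit_descent (Suc n)) =
      (\<Sum>i\<le>n. card (perms231 no_unit_descent i) * ?d (n - i))" .
  \<comment> \<open>Starting with the maximum means that \<open>R\<close> is empty, so only
    \<open>i = n\<close> survives.\<close>
  have "card (perms231 (\<lambda>\<pi>. no_unit_descent \<pi> \<and> starts_max \<pi>) (Suc n)) =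
      (\<Sum>i\<le>n. ?d i * card (perms231 (\<lambda>\<pi>. \<pi> = []) (n - i)))"
    by (rule card_perms231_Suc)
      (auto simp: no_unit_descent_glue starts_max_glue, simp add: no_unit_descent_def)
  also have "\<dots> = (\<Sum>i\<le>n. if i = n then ?d n else 0)"
    by (intro sum.cong) (auto simp: perms231_Nil)
  finally show "card (perms231 no_unit_descent (Suc n)) = ?d n + ?d (Suc n)"
    by (subst card_perms231_split[where S = starts_max]) simp
qed

section \<open>Identification with the Motzkin numbers\<close>

lemma motzkin_gf:
  defines "M \<equiv> Abs_fps (\<lambda>n. int (motzkin n))"
  shows "M = 1 + fps_X * M + fps_X ^ 2 * M ^ 2"
proof (rule fps_ext)
  fix n
  have nth [simp]: "fps_nth M n = int (motzkin n)" for n by (simp add: M_def)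
  have MM: "fps_nth (M * M) n = (\<Sum>i\<le>n. int (motzkin i) * int (motzkin (n - i)))" for n
    by (simp add: fps_mult_nth atLeast0AtMost)
  have X2: "fps_X ^ 2 * M ^ 2 = fps_X * (fps_X * (M * M))"
    by (simp add: power2_eq_square algebra_simps)
  \<comment> \<open>The factor x^2 makes the convolution appear from index 2 on; at index 1 the sum
    in the recurrence is empty.\<close>
  consider "n = 0" | "n = 1" | k where "n = Suc (Suc k)"
    by (metis One_nat_def not0_implies_Suc)
  then show "fps_nth M n = fps_nth (1 + fps_X * M + fps_X ^ 2 * M ^ 2) n"
  proof cases
    case (3 k)
    have "fps_nth (1 + fps_X * M + fps_X * (fps_X * (M * M))) n =
        int (motzkin (Suc k)) + fps_nth (M * M) k"
      unfolding 3 fps_add_nth fps_X_mult_nth by simp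
    also have "\<dots> = fps_nth M n"
      unfolding 3 MM by (simp add: lessThan_Suc_atMost del: motzkin.simps) (simp add: lessThan_Suc_atMost)
    finally show ?thesis unfolding X2 by simp
  qed (simp_all add: X2)
qed

text \<open>1 + x M solves the same quadratic equation. The difference of two solutions is
  annihilated by a series with constant term 1, so it vanishes in the integral domain of integer
  power series.\<close>

lemma gf_equation_imp_motzkin:
  fixes P :: "int fps"
  assumes "P = fps_X * P ^ 2 - fps_X * (P - 1) + 1"
  shows "P = 1 + fps_X * Abs_fps (\<lambda>n. int (motzkin n))"
proof -
  define M where "M = Abs_fps (\<lambda>n. int (motzkin n))"
  define T where "T = 1 + fps_X * M"
  have "T = fps_X * T ^ 2 - fps_X * (T - 1) + 1"
    unfolding T_def using arg_cong[OF motzkin_gf, of "\<lambda>F. fps_X * F"]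
    by (simp add: M_def[symmetric] algebra_simps power2_eq_square)
  with assms have "(P - T) * (1 + fps_X - fps_X * (P + T)) = 0"
    by (simp add: algebra_simps power2_eq_square)
  moreover have "fps_nth (1 + fps_X - fps_X * (P + T)) 0 = 1" by simp
  then have "1 + fps_X - fps_X * (P + T) \<noteq> 0" by (metis fps_zero_nth zero_neq_one)
  ultimately show ?thesis by (simp add: T_def M_def)
qed

theorem mainTheorem10:
  shows "(\<forall>n. card (Av n {classical [2, 3, 1], m1}) = card (Av n {classical [2, 3, 1], m2})) \<and>
    (\<forall>m \<in> {m1, m2}. let P = Av_gf {classical [2, 3, 1], m} in
       P = fps_X * P ^ 2 - fps_X * (P - 1) + 1 \<and>
       map (fps_nth P) [0..<8] = [1, 1, 1, 2, 4, 9, 21, 51] \<and>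
       (\<forall>n \<ge> 1. fps_nth P n = int (motzkin (n - 1))))"
proof -
  let ?T = "1 + fps_X * Abs_fps (\<lambda>n. int (motzkin n))"
  have gf: "Av_gf {classical [2, 3, 1], m} = ?T" if "m \<in> {m1, m2}" for m
    using that gf_m1[THEN gf_equation_imp_motzkin] gf_m2[THEN gf_equation_imp_motzkin] by auto
  have nth: "fps_nth ?T (Suc n) = int (motzkin n)" for n by simp
  have "card (Av n {classical [2, 3, 1], m1}) = card (Av n {classical [2, 3, 1], m2})" for n
    using arg_cong[OF trans[OF gf[of m1] gf[of m2, symmetric]], of "\<lambda>F. fps_nth F n"]
    by (simp add: Av_gf_def)
  moreover have "map (fps_nth ?T) [0..<8] = [1, 1, 1, 2, 4, 9, 21, 51]"
  proof -
    \<comment> \<open>The coefficient at 0 is separate; from index 1 on the coefficients are the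
      Motzkin numbers shifted by one.\<close>
    have "[0..<8] = 0 # map Suc [0..<7]" by (simp add: map_Suc_upt upt_conv_Cons)
    then have "map (fps_nth ?T) [0..<8] = fps_nth ?T 0 # map (int \<circ> motzkin) [0..<7]"
      by (simp only: list.map map_map comp_def nth)
    also have "\<dots> = 1 # map int (map motzkin [0..<7])" by (simp del: upt_rec_numeral)
    finally show ?thesis unfolding motzkin_values by simp
  qed
  moreover have "fps_nth ?T n = int (motzkin (n - 1))" if "n \<ge> 1" for n
    using that by (cases n) simp_all
  ultimately show ?thesis unfolding Let_def using gf gf_m1 gf_m2 by auto
qed

end
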